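(* Let $(\Omega_t)_{t\ge0}$ be a family of simply connected domains $\Omega_t\subset\mathbb{C}$. Suppose that $\Omega_s\subset\Omega_t\neq\mathbb{C}$ for all $s\ge0$ and $t\ge s$. Then the following assertions are equivalent: (1) The family $(\Omega_t)_{t\ge0}$ is an inclusion chain. (2) There exists $w_*\in\Omega_0$ such that the function $t\in[0,+\infty)\mapsto\mu_{w_*}(t):=r(\Omega_t,w_* )$ is continuous. (3) For all $w_*\in\Omega_0$ the function $t\in[0,+\infty)\mapsto\mu_{w_*}(t):=r(\Omega_t,w_* )$ is non-decreasing and continuous.
   Context: $r(D,z)$ denotes the conformal radius of a simply connected domain $D\subsetneq\mathbb{C}$ with respect to $z\in D$, i.e. $r(D,z)=|f'(0)|$ where $f$ is a conformal map of the unit disk onto $D$ with $f(0)=z$. A family $(\Omega_t)_{t\ge0}$ of simply connected domains $\Omega_t\subset\mathbb{C}$, $\Omega_t\ne\mathbb{C}$ for all $t\ge 0$, is an inclusion chain if: IC1. $\Omega_s\subset\Omega_t$ whenever $t\ge s\ge0$; IC2. whenever $t_n\to t_0$ in $[0,+\infty)$, $\Omega_{t_n}\to\Omega_{t_0}$ in the sense of (Carathéodory) kernel convergence with respect to any point of $\Omega_0$. Kernel convergence: for a sequence of domains $D_n$ all containing a fixed neighbourhood of $w_0$, the kernel with respect to $w_0$ is the largest domain $D\ni w_0$ such that every compact subset of $D$ is contained in $D_n$ for all sufficiently large $n$; $D_n\to D$ with respect to $w_0$ means that every subsequence of $(D_n)$ has the same kernel $D$ with respect to $w_0$. *)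

theory Defs
  imports "HOL-Complex_Analysis.Complex_Analysis"
begin

definition plane_domain :: "complex set \<Rightarrow> bool" where
  "plane_domain D \<longleftrightarrow> open D \<and> connected D \<and> D \<noteq> {}"

(* The library's simply_connected admits the empty set, which plane_domain excludes. *)
definition simply_connected_domain :: "complex set \<Rightarrow> bool" where
  "simply_connected_domain D \<longleftrightarrow> plane_domain D \<and> simply_connected D"

definition conformal_map :: "(complex \<Rightarrow> complex) \<Rightarrow> complex set \<Rightarrow> complex set \<Rightarrow> bool" where
  "conformal_map f U V \<longleftrightarrow> f holomorphic_on U \<and> bij_betw f U V"

(* Well defined for a simply connected domain D \<noteq> UNIV with z \<in> D: f exists by the Riemann
   mapping theorem and is unique up to a rotation of the disk, which preserves |f'(0)|.
   Otherwise the value is unspecified. *)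
definition conformal_radius :: "complex set \<Rightarrow> complex \<Rightarrow> real" where
  "conformal_radius D z =
     (THE r. \<exists>f. conformal_map f (ball 0 1) D \<and> f 0 = z \<and> r = norm (deriv f 0))"

definition eventually_exhausted :: "(nat \<Rightarrow> complex set) \<Rightarrow> complex set \<Rightarrow> bool" where
  "eventually_exhausted D K \<longleftrightarrow>
     (\<forall>C. compact C \<and> C \<subseteq> K \<longrightarrow> (\<forall>\<^sub>F n in sequentially. C \<subseteq> D n))"

(* "Largest" is with respect to inclusion. *)
definition is_kernel :: "complex \<Rightarrow> (nat \<Rightarrow> complex set) \<Rightarrow> complex set \<Rightarrow> bool" where
  "is_kernel w D K \<longleftrightarrow>
     (plane_domain K \<and> w \<in> K \<and> eventually_exhausted D K) \<and>
     (\<forall>K'. plane_domain K' \<and> w \<in> K' \<and> eventually_exhausted D K' \<longrightarrow> K' \<subseteq> K)"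

(* The first two conjuncts are the standing assumptions under which kernels are considered. *)
definition kernel_converges :: "complex \<Rightarrow> (nat \<Rightarrow> complex set) \<Rightarrow> complex set \<Rightarrow> bool" where
  "kernel_converges w D K \<longleftrightarrow>
     (\<forall>n. plane_domain (D n)) \<and>
     (\<exists>U. open U \<and> w \<in> U \<and> (\<forall>n. U \<subseteq> D n)) \<and>
     (\<forall>\<phi>::nat \<Rightarrow> nat. strict_mono \<phi> \<longrightarrow> is_kernel w (D \<circ> \<phi>) K)"

(* The family is indexed by [0, \<infinity>); the values of \<Omega> at negative arguments are irrelevant. *)
definition inclusion_chain :: "(real \<Rightarrow> complex set) \<Rightarrow> bool" where
  "inclusion_chain \<Omega> \<longleftrightarrow>
     (\<forall>t\<ge>0. simply_connected_domain (\<Omega> t) \<and> \<Omega> t \<noteq> UNIV) \<and>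
     (\<forall>s t. 0 \<le> s \<and> s \<le> t \<longrightarrow> \<Omega> s \<subseteq> \<Omega> t) \<and>
     (\<forall>\<tau> t\<^sub>0. (\<forall>n::nat. 0 \<le> \<tau> n) \<and> 0 \<le> t\<^sub>0 \<and> \<tau> \<longlonglongrightarrow> t\<^sub>0 \<longrightarrow>
        (\<forall>w\<in>\<Omega> 0. kernel_converges w (\<lambda>n. \<Omega> (\<tau> n)) (\<Omega> t\<^sub>0)))"

end

theory Submission
  imports Defs "HOL-Real_Asymp.Real_Asymp"
begin

text \<open>
  Along an increasing family, kernel convergence amounts to two one-sided conditions in which no
  sequences occur: for \<open>t > 0\<close> every compact subset of \<open>\<Omega> t\<close> lies in some earlier domain, and a
  plane domain that meets \<open>\<Omega> 0\<close> and lies in all later domains lies in \<open>\<Omega> t\<close>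
  (\<open>inclusion_chain_iff\<close>).  The conformal radius at a fixed point \<open>w\<close> of \<open>\<Omega> 0\<close> is
  non-decreasing by the Schwarz lemma, so its continuity also splits into a left and a right half.
  These halves are equivalent to the two conditions on the domains, separately and for each \<open>w\<close>
  (\<open>left_continuous_iff\<close>, \<open>right_continuous_iff\<close>).  Since the conditions on the domains do not
  mention \<open>w\<close>, continuity at one point implies continuity at all points.

  From domains to radii the Schwarz lemma suffices on the left; on the right, a normal family
  argument produces a limit of Riemann maps whose image lies in all later domains
  (\<open>limit_map_into_decreasing_domains\<close>).

  From radii to domains, nearly equal radii have to force nearly equal domains.  The quantitative
  reason is \<open>deriv_bound_of_omitted_value\<close>: a holomorphic self-map \<open>h\<close> of the unit disk that
  fixes 0 and omits a point \<open>p\<close> satisfies \<open>|h'(0)| \<le> 2 \<surd>|p| / (1 + |p|) < 1\<close>.  It is applied to the inclusion of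
  the smaller domain into the larger one, read in Riemann maps of both.  It remains to keep the
  preimages of omitted points, under the Riemann map of the larger domain, in a fixed disk of
  radius less than 1.  On the left this is compactness, because the target domain is fixed; on
  the right, where the target varies, it is \<open>uniform_bound_of_disk_valued\<close>.
\<close>

section \<open>Riemann maps and the conformal radius\<close>

lemma compact_subset_unit_disk:
  fixes K :: "complex set"
  assumes "compact K" "K \<subseteq> ball 0 1"
  obtains r where "0 < r" "r < 1" "K \<subseteq> cball 0 r"
proof -
  obtain s where s: "s < 1" "\<And>z. z \<in> K \<Longrightarrow> norm z \<le> s"
  proof (cases "K = {}")
    case True
    then show ?thesis
      using that [of 0] by simp
  next
    case False
    obtain x where "x \<in> K" "\<And>y. y \<in> K \<Longrightarrow> dist 0 y \<le> dist 0 x"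
      using distance_attains_sup [OF assms(1) False, of 0] by blast
    then show ?thesis
      using that [of "norm x"] assms(2) by auto
  qed
  show ?thesis
    by (rule that [of "max s (1/2)"]) (use s in \<open>auto simp: le_max_iff_disj\<close>)
qed

lemma conformal_map_inverse:
  assumes "conformal_map f U V" "open U"
  obtains g where "g holomorphic_on V" "g ` V \<subseteq> U"
    "\<And>z. z \<in> U \<Longrightarrow> g (f z) = z" "\<And>v. v \<in> V \<Longrightarrow> f (g v) = v"
proof -
  have f: "f holomorphic_on U" "inj_on f U" "f ` U = V"
    using assms by (auto simp: conformal_map_def bij_betw_def)
  obtain g where g: "g holomorphic_on f ` U" "\<And>z. z \<in> U \<Longrightarrow> g (f z) = z"
    using holomorphic_has_inverse [OF f(1) assms(2) f(2)] by metis
  show ?thesis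
    by (rule that [of g]) (use f g in auto)
qed

text \<open>A competitor on the disk factors through a Riemann map of the target, so questions about
  it become questions about self-maps of the disk fixing the centre.\<close>

lemma factor_through_riemann_map:
  assumes f: "conformal_map f (ball 0 1) D"
    and g: "g holomorphic_on ball 0 1" "g ` ball 0 1 \<subseteq> D" "g 0 = f 0"
  obtains h where "h holomorphic_on ball 0 1" "h ` ball 0 1 \<subseteq> ball 0 1" "h 0 = 0"
    "\<And>z. norm z < 1 \<Longrightarrow> g z = f (h z)" "deriv g 0 = deriv f 0 * deriv h 0"
proof -
  have holf: "f holomorphic_on ball 0 1"
    using f by (simp add: conformal_map_def)
  obtain k where k: "k holomorphic_on D" "k ` D \<subseteq> ball 0 1"
    "\<And>z. z \<in> ball 0 1 \<Longrightarrow> k (f z) = z" "\<And>v. v \<in> D \<Longrightarrow> f (k v) = v"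
    using conformal_map_inverse [OF f open_ball] by metis
  define h where "h = k \<circ> g"
  have holh: "h holomorphic_on ball 0 1"
    unfolding h_def by (rule holomorphic_on_compose_gen [OF g(1) k(1) g(2)])
  have imh: "h ` ball 0 1 \<subseteq> ball 0 1"
    using g(2) k(2) by (auto simp: h_def)
  have h0: "h 0 = 0"
    using g(3) k(3)[of 0] by (simp add: h_def)
  have eq: "g z = f (h z)" if "norm z < 1" for z
    using that g(2) k(4) by (auto simp: h_def image_subset_iff)
  have "((f \<circ> h) has_field_derivative deriv f 0 * deriv h 0) (at 0)"
    by (rule DERIV_chain) (use holf holh h0 in \<open>auto intro!: holomorphic_derivI\<close>)
  then have "(g has_field_derivative deriv f 0 * deriv h 0) (at 0)"
    by (rule has_field_derivative_transform_within_open [OF _ open_ball [of 0 1]]) (use eq h0 in auto)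
  then show ?thesis
    using that holh imh h0 eq DERIV_imp_deriv by blast
qed

lemma schwarz_comparison:
  assumes f: "conformal_map f (ball 0 1) D"
    and g: "g holomorphic_on ball 0 1" "g ` ball 0 1 \<subseteq> D" "g 0 = f 0"
  shows "norm (deriv g 0) \<le> norm (deriv f 0)"
    and "r < 1 \<Longrightarrow> g ` cball 0 r \<subseteq> f ` cball 0 r"
proof -
  obtain h where h: "h holomorphic_on ball 0 1" "h ` ball 0 1 \<subseteq> ball 0 1" "h 0 = 0"
    "\<And>z. norm z < 1 \<Longrightarrow> g z = f (h z)" "deriv g 0 = deriv f 0 * deriv h 0"
    using factor_through_riemann_map [OF assms] by metis
  have no: "norm (h z) < 1" if "norm z < 1" for z
    using h(2) that by (auto simp: image_subset_iff)
  have "norm (deriv h 0) \<le> 1"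
    using Schwarz_Lemma(2) [OF h(1,3) no, of 0] by simp
  then show "norm (deriv g 0) \<le> norm (deriv f 0)"
    by (simp add: h(5) norm_mult mult_left_le)
  show "g ` cball 0 r \<subseteq> f ` cball 0 r" if "r < 1"
  proof clarify
    fix z :: complex
    assume z: "z \<in> cball 0 r"
    then have "norm z < 1" "norm (h z) \<le> r"
      using Schwarz_Lemma(1) [OF h(1,3) no, of z] that by auto
    then show "g z \<in> f ` cball 0 r"
      using h(4) by auto
  qed
qed

lemma conformal_radius_eq:
  assumes f: "conformal_map f (ball 0 1) D"
  shows "conformal_radius D (f 0) = norm (deriv f 0)"
  unfolding conformal_radius_def
proof (rule the_equality)
  show "\<exists>g. conformal_map g (ball 0 1) D \<and> g 0 = f 0 \<and> norm (deriv f 0) = norm (deriv g 0)"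
    using f by blast
next
  fix r
  assume "\<exists>g. conformal_map g (ball 0 1) D \<and> g 0 = f 0 \<and> r = norm (deriv g 0)"
  then obtain g where g: "conformal_map g (ball 0 1) D" "g 0 = f 0" "r = norm (deriv g 0)"
    by blast
  have "norm (deriv g 0) \<le> norm (deriv f 0)" "norm (deriv f 0) \<le> norm (deriv g 0)"
    by (rule schwarz_comparison(1) [where D = D];
        use f g in \<open>auto simp: conformal_map_def bij_betw_def\<close>)+
  then show "r = norm (deriv f 0)"
    using g(3) by simp
qed

lemma riemann_map_exists:
  assumes D: "simply_connected_domain D" "D \<noteq> UNIV" and "w \<in> D"
  obtains f where "conformal_map f (ball 0 1) D" "f 0 = w"
    "norm (deriv f 0) = conformal_radius D w" "conformal_radius D w > 0"
proof -
  have "open D" "simply_connected D" "D \<noteq> {}"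
    using D(1) by (auto simp: simply_connected_domain_def plane_domain_def)
  then obtain p q where p: "p holomorphic_on D" "\<forall>z\<in>D. p z \<in> ball 0 1 \<and> q (p z) = z"
    and q: "q holomorphic_on ball 0 1" "\<forall>z\<in>ball 0 1. q z \<in> D \<and> p (q z) = z"
    using simply_connected_eq_biholomorphic_to_disc [OF \<open>open D\<close>] D(2) by metis
  have "p w \<in> ball 0 1"
    using p(2) \<open>w \<in> D\<close> by blast
  then obtain a b where ab: "a (p w) = 0" "a holomorphic_on ball 0 1"
    "a ` ball 0 1 \<subseteq> ball 0 1" "b holomorphic_on ball 0 1" "b ` ball 0 1 \<subseteq> ball 0 1"
    "\<And>z. z \<in> ball 0 1 \<Longrightarrow> a (b z) = z" "\<And>z. z \<in> ball 0 1 \<Longrightarrow> b (a z) = z"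
    by (rule ball_biholomorphism_exists) blast
  define f where "f = q \<circ> b"
  have holf: "f holomorphic_on ball 0 1"
    unfolding f_def by (rule holomorphic_on_compose_gen [OF ab(4) q(1) ab(5)])
  have bij: "bij_betw f (ball 0 1) D"
  proof (rule bij_betw_byWitness [where f' = "a \<circ> p"])
    show "\<forall>z\<in>ball 0 1. (a \<circ> p) (f z) = z"
      using ab q(2) by (auto simp: f_def image_subset_iff)
    show "\<forall>v\<in>D. f ((a \<circ> p) v) = v"
      using ab p(2) by (auto simp: f_def)
    show "f ` ball 0 1 \<subseteq> D"
      using ab q(2) by (auto simp: f_def image_subset_iff)
    show "(a \<circ> p) ` D \<subseteq> ball 0 1"
      using ab p(2) by (auto simp: image_subset_iff)
  qed
  have f: "conformal_map f (ball 0 1) D"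
    using holf bij by (simp add: conformal_map_def)
  have f0: "f 0 = w"
    using ab(1) ab(7)[OF \<open>p w \<in> ball 0 1\<close>] p(2) \<open>w \<in> D\<close> by (simp add: f_def)
  have "deriv f 0 \<noteq> 0"
    using holomorphic_injective_imp_regular [OF holf open_ball] bij
    by (auto simp: bij_betw_def)
  then show ?thesis
    using that f f0 conformal_radius_eq [OF f] by simp
qed

section \<open>Self-maps of the disk that omit a value\<close>

lemma Moebius_function_has_derivative:
  assumes "norm w < 1" "norm z < 1"
  shows "(Moebius_function 0 w has_field_derivative
           of_real (1 - (norm w)\<^sup>2) / (1 - cnj w * z)\<^sup>2) (at z)"
proof -
  have "norm (cnj w * z) < 1"
    using assms norm_mult_less [of "cnj w" 1 z 1] by simp
  then have nz: "1 - cnj w * z \<noteq> 0"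
    by (metis less_irrefl norm_one right_minus_eq)
  have M: "Moebius_function 0 w = (\<lambda>z. (z - w) / (1 - cnj w * z))"
    by (auto simp: Moebius_function_def)
  have "((\<lambda>z. 1 - cnj w * z) has_field_derivative - cnj w) (at z)"
    by (auto intro!: derivative_eq_intros)
  moreover have "((\<lambda>z. z - w) has_field_derivative 1) (at z)"
    by (auto intro!: derivative_eq_intros)
  ultimately have "(Moebius_function 0 w has_field_derivative
      (1 * (1 - cnj w * z) - (z - w) * - cnj w) / ((1 - cnj w * z) * (1 - cnj w * z))) (at z)"
    unfolding M using DERIV_divide nz by blast
  moreover have "1 * (1 - cnj w * z) - (z - w) * - cnj w = of_real (1 - (norm w)\<^sup>2)"
    unfolding of_real_diff complex_norm_square by (simp add: algebra_simps)
  ultimately show ?thesis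
    by (simp only: power2_eq_square)
qed

text \<open>The bound is the modulus of the derivative at 0 of the two-sheeted self-covering of the
  disk that is branched over \<open>p\<close> and fixes 0.  Composing with the automorphism that sends \<open>p\<close> to the
  centre makes the map zero-free, a square root exists because the disk is simply connected, and
  the Schwarz lemma is applied to that root after moving its centre value back to 0.  What matters
  below is that the bound is smaller than 1, uniformly for \<open>p\<close> in compact parts of the disk.\<close>

lemma deriv_bound_of_omitted_value:
  assumes h: "h holomorphic_on ball 0 1" "h ` ball 0 1 \<subseteq> ball 0 1" "h 0 = 0"
    and p: "norm p < 1" "p \<notin> h ` ball 0 1"
  shows "norm (deriv h 0) \<le> 2 * sqrt (norm p) / (1 + norm p)"
proof -
  have no: "norm (h z) < 1" if "norm z < 1" for z
    using h(2) that by (auto simp: image_subset_iff)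
  define k where "k = Moebius_function 0 p \<circ> h"
  have holk: "k holomorphic_on ball 0 1"
    unfolding k_def
    by (rule holomorphic_on_compose_gen [OF h(1) Moebius_function_holomorphic h(2)]) (rule p(1))
  have "k z \<noteq> 0" if "norm z < 1" for z
  proof
    assume "k z = 0"
    moreover have "norm (cnj p * h z) < 1"
      using p(1) no [OF that] norm_mult_less [of "cnj p" 1 "h z" 1] by simp
    ultimately have "h z = p"
      by (auto simp: k_def Moebius_function_simple)
    with p(2) that show False
      by force
  qed
  moreover have "simply_connected (ball (0::complex) 1)"
    by (simp add: convex_imp_simply_connected)
  ultimately obtain g where holg: "g holomorphic_on ball 0 1"
    and g: "\<And>z. norm z < 1 \<Longrightarrow> k z = (g z)\<^sup>2"
    using simply_connected_eq_holomorphic_sqrt [OF open_ball, of "0::complex" 1] holk by auto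
  have ng: "norm (g z) < 1" if "norm z < 1" for z
  proof -
    have "(norm (g z))\<^sup>2 < 1"
      using Moebius_function_norm_lt_1 [OF p(1) no [OF that], of 0] g [OF that]
      by (simp add: k_def norm_power)
    then show ?thesis
      by (simp add: power2_less_1_iff abs_square_less_1)
  qed
  define q where "q = g 0"
  have q1: "norm q < 1"
    using ng [of 0] by (simp add: q_def)
  have qp: "q\<^sup>2 = - p"
    using g [of 0] h(3) by (simp add: q_def k_def Moebius_function_simple)
  then have nq: "(norm q)\<^sup>2 = norm p"
    by (metis norm_minus_cancel norm_power)
  define G where "G = Moebius_function 0 q \<circ> g"
  have imG: "norm (G z) < 1" if "norm z < 1" for z
    using Moebius_function_norm_lt_1 [OF q1 ng [OF that]] by (simp add: G_def)
  have "G holomorphic_on ball 0 1"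
    unfolding G_def
    by (rule holomorphic_on_compose_gen [OF holg Moebius_function_holomorphic])
       (use q1 ng in auto)
  moreover have "G 0 = 0"
    by (simp add: G_def q_def Moebius_function_eq_zero)
  ultimately have dG: "norm (deriv G 0) \<le> 1"
    using Schwarz_Lemma(2) [of G 0] imG by simp
  have g': "(g has_field_derivative deriv g 0) (at 0)"
    by (rule holomorphic_derivI [OF holg]) auto
  have h': "(h has_field_derivative deriv h 0) (at 0)"
    by (rule holomorphic_derivI [OF h(1)]) auto
  have qq: "1 - cnj q * q = of_real (1 - norm p)"
    using nq complex_norm_square [of q] by (simp add: mult.commute)
  have "(G has_field_derivative of_real (1 - (norm q)\<^sup>2) / (1 - cnj q * q)\<^sup>2 * deriv g 0) (at 0)"
    unfolding G_def q_def
    by (rule DERIV_chain [OF _ g']) (use Moebius_function_has_derivative q1 in \<open>simp add: q_def\<close>)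
  then have "deriv G 0 = of_real (1 - norm p) / (of_real (1 - norm p))\<^sup>2 * deriv g 0"
    unfolding qq nq by (rule DERIV_imp_deriv)
  also have "\<dots> = deriv g 0 / of_real (1 - norm p)"
    by (simp add: power2_eq_square)
  finally have "norm (deriv g 0) / \<bar>1 - norm p\<bar> \<le> 1"
    using dG by (simp only: norm_divide norm_of_real)
  then have dg: "norm (deriv g 0) \<le> 1 - norm p"
    using p(1) by (simp add: divide_simps)
  have "(k has_field_derivative of_real (1 - (norm p)\<^sup>2) * deriv h 0) (at 0)"
    unfolding k_def
    by (rule DERIV_chain [OF _ h']) (use Moebius_function_has_derivative [OF p(1), of 0] h(3) in simp)
  moreover have "(k has_field_derivative 2 * q * deriv g 0) (at 0)"
  proof (rule has_field_derivative_transform_within_open [OF _ open_ball [of 0 1]])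
    show "((\<lambda>z. (g z)\<^sup>2) has_field_derivative 2 * q * deriv g 0) (at 0)"
      using g' by (auto intro!: derivative_eq_intros simp: q_def)
  qed (use g in auto)
  ultimately have "of_real (1 - (norm p)\<^sup>2) * deriv h 0 = 2 * q * deriv g 0"
    by (rule DERIV_unique)
  then have "norm (of_real (1 - (norm p)\<^sup>2) * deriv h 0) = norm (2 * q * deriv g 0)"
    by simp
  moreover have pos: "1 - (norm p)\<^sup>2 = (1 - norm p) * (1 + norm p)"
    by (simp add: power2_eq_square algebra_simps)
  ultimately have "(1 - norm p) * (1 + norm p) * norm (deriv h 0) = 2 * norm q * norm (deriv g 0)"
    using p(1) by (simp only: norm_mult norm_of_real) (simp add: abs_mult)
  also have "\<dots> \<le> 2 * norm q * (1 - norm p)"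
    using dg by (simp add: mult_left_mono)
  finally have "(1 - norm p) * ((1 + norm p) * norm (deriv h 0)) \<le> (1 - norm p) * (2 * norm q)"
    by (simp add: algebra_simps)
  then have "(1 + norm p) * norm (deriv h 0) \<le> 2 * norm q"
    using p(1) by simp
  moreover have "norm q = sqrt (norm p)"
    using nq by (metis norm_ge_zero real_sqrt_unique)
  moreover have "0 < 1 + norm p"
    by (simp add: add_pos_nonneg)
  ultimately show ?thesis
    by (simp add: pos_le_divide_eq mult.commute)
qed

lemma sqrt_bound_less_1: "2 * sqrt r / (1 + r) < 1" if "0 \<le> r" "r < 1" for r :: real
proof -
  have "sqrt r \<noteq> 1"
    using that by simp
  then have "0 < (1 - sqrt r)\<^sup>2"
    by simp
  also have "(1 - sqrt r)\<^sup>2 = 1 + r - 2 * sqrt r"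
    using that(1) by (simp add: power2_diff)
  finally show ?thesis
    using that(1) by (simp add: pos_divide_less_eq)
qed

lemma sqrt_bound_mono:
  fixes x r :: real
  assumes "0 \<le> x" "x \<le> r" "r \<le> 1"
  shows "2 * sqrt x / (1 + x) \<le> 2 * sqrt r / (1 + r)"
proof -
  define a b where "a = sqrt x" and "b = sqrt r"
  have ab: "0 \<le> a" "a \<le> b" "b \<le> 1" "x = a\<^sup>2" "r = b\<^sup>2"
    using assms by (auto simp: a_def b_def)
  have "a * b \<le> 1"
    using ab by (metis mult_le_one order.trans)
  then have "0 \<le> (b - a) * (1 - a * b)"
    using ab by simp
  then have "a * (1 + b\<^sup>2) \<le> b * (1 + a\<^sup>2)"
    by (simp add: algebra_simps power2_eq_square)
  moreover have "0 < 1 + a\<^sup>2" "0 < 1 + b\<^sup>2"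
    by (simp_all add: add_pos_nonneg)
  ultimately have "2 * a / (1 + a\<^sup>2) \<le> 2 * b / (1 + b\<^sup>2)"
    by (simp add: pos_divide_le_eq pos_le_divide_eq)
  then show ?thesis
    using ab by simp
qed

text \<open>A larger domain whose Riemann map reaches the omitted point already at radius \<open>r < 1\<close> has a
  strictly larger conformal radius, by a factor controlled by \<open>r\<close> alone.\<close>

lemma deriv_bound_of_omitted_point:
  assumes f: "conformal_map f (ball 0 1) D"
    and g: "g holomorphic_on ball 0 1" "g ` ball 0 1 \<subseteq> D" "g 0 = f 0"
    and z: "norm z \<le> r" "r < 1" "f z \<notin> g ` ball 0 1"
  shows "norm (deriv g 0) \<le> 2 * sqrt r / (1 + r) * norm (deriv f 0)"
proof -
  obtain h where h: "h holomorphic_on ball 0 1" "h ` ball 0 1 \<subseteq> ball 0 1" "h 0 = 0"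
    "\<And>u. norm u < 1 \<Longrightarrow> g u = f (h u)" "deriv g 0 = deriv f 0 * deriv h 0"
    using factor_through_riemann_map [OF f g] by metis
  have "z \<notin> h ` ball 0 1"
    using z(3) h(4) by force
  then have "norm (deriv h 0) \<le> 2 * sqrt (norm z) / (1 + norm z)"
    using deriv_bound_of_omitted_value [OF h(1-3)] z by simp
  also have "\<dots> \<le> 2 * sqrt r / (1 + r)"
    by (rule sqrt_bound_mono) (use z in auto)
  finally have "norm (deriv f 0) * norm (deriv h 0) \<le> norm (deriv f 0) * (2 * sqrt r / (1 + r))"
    by (rule mult_left_mono) simp
  then show ?thesis
    by (simp only: h(5) norm_mult mult.commute)
qed

section \<open>Two compactness arguments\<close>

text \<open>Since the maps \<open>h\<close> form a normal family, a sequence with \<open>|h p|\<close> tending to 1 would have a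
  limit that attains the maximum modulus 1 at \<open>p\<close>, hence a constant one, although it vanishes
  at \<open>w\<close>.\<close>

lemma uniform_bound_of_disk_valued:
  assumes V: "open V" "connected V" "w \<in> V" "p \<in> V"
  obtains r where "0 < r" "r < 1"
    "\<And>h. h holomorphic_on V \<Longrightarrow> h ` V \<subseteq> ball 0 1 \<Longrightarrow> h w = 0 \<Longrightarrow> norm (h p) \<le> r"
proof -
  define H where "H = {h. h holomorphic_on V \<and> h ` V \<subseteq> ball (0::complex) 1 \<and> h w = 0}"
  have "\<exists>r. 0 < r \<and> r < 1 \<and> (\<forall>h\<in>H. norm (h p) \<le> r)"
  proof (rule ccontr)
    assume no: "\<not> ?thesis"
    have "\<exists>h\<in>H. norm (h p) > 1 - 1 / (real n + 2)" for n
    proof -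
      have "0 < 1 - 1 / (real n + 2)" "1 - 1 / (real n + 2) < 1"
        by (auto simp: divide_simps)
      with no show ?thesis
        by (meson not_le)
    qed
    then obtain F where F: "\<And>n. F n \<in> H" "\<And>n. norm (F n p) > 1 - 1 / (real n + 2)"
      by metis
    have FV: "norm (h z) < 1" if "h \<in> H" "z \<in> V" for h z
      using that by (auto simp: H_def image_subset_iff)
    obtain g s where g: "g holomorphic_on V" and s: "strict_mono (s :: nat \<Rightarrow> nat)"
      and lim: "\<And>x. x \<in> V \<Longrightarrow> (\<lambda>n. F (s n) x) \<longlonglongrightarrow> g x"
    proof (rule Montel [OF V(1), of H F])
      show "h holomorphic_on V" if "h \<in> H" for h
        using that by (simp add: H_def)
      show "\<exists>B. \<forall>h\<in>H. \<forall>z\<in>K. norm (h z) \<le> B" if "compact K" "K \<subseteq> V" for K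
        using that FV by (intro exI [of _ 1]) (force intro: less_imp_le)
    qed (use F in auto)
    have le: "norm (g z) \<le> 1" if "z \<in> V" for z
      by (rule tendsto_upperbound [OF tendsto_norm [OF lim [OF that]]])
         (use F FV that in \<open>auto intro!: always_eventually less_imp_le\<close>)
    have *: "(\<lambda>n. 1 - 1 / (real (s n) + 2)) \<longlonglongrightarrow> 1 - 0"
    proof (intro tendsto_intros)
      have "(\<lambda>n. 1 / (real n + 2)) \<longlonglongrightarrow> 0"
        by real_asymp
      from LIMSEQ_subseq_LIMSEQ [OF this s] show "(\<lambda>n. 1 / (real (s n) + 2)) \<longlonglongrightarrow> 0"
        by (simp add: o_def)
    qed
    have "\<forall>\<^sub>F n in sequentially. 1 - 1 / (real (s n) + 2) \<le> norm (F (s n) p)"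
      by (intro always_eventually allI less_imp_le F(2))
    from tendsto_le [OF trivial_limit_sequentially tendsto_norm [OF lim [OF V(4)]] * this]
    have ge: "1 \<le> norm (g p)"
      by simp
    have "g constant_on V"
      by (rule maximum_modulus_principle [OF g V(1,2) V(1) order_refl V(4)])
         (use le ge in \<open>fastforce intro: order.trans\<close>)
    then have "g p = g w"
      using V by (auto simp: constant_on_def)
    moreover have "g w = 0"
      using lim [OF V(3)] F(1) LIMSEQ_unique [OF _ tendsto_const] by (simp add: H_def)
    ultimately show False
      using ge by simp
  qed
  then show ?thesis
    using that by (auto simp: H_def)
qed

text \<open>By the Schwarz lemma \<open>f\<^sub>n\<close> maps the closed disk of radius \<open>\<rho>\<close> into its image under \<open>f\<^sub>m\<close> for
  \<open>n \<ge> m\<close>.  These images are compact, which makes the Riemann maps a normal family and keeps a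
  limit function inside every \<open>D\<^sub>m\<close>, not merely inside its closure.\<close>

lemma limit_map_into_decreasing_domains:
  fixes D :: "nat \<Rightarrow> complex set"
  assumes f: "\<And>n. conformal_map (f n) (ball 0 1) (D n)" "\<And>n. f n 0 = w"
    and D: "decseq D" and c: "\<And>n. c \<le> norm (deriv (f n) 0)"
  obtains g where "g holomorphic_on ball 0 1" "g 0 = w" "\<And>n. g ` ball 0 1 \<subseteq> D n"
    "c \<le> norm (deriv g 0)"
proof -
  have holf: "f n holomorphic_on ball 0 1" and imf: "f n ` ball 0 1 = D n" for n
    using f(1) by (auto simp: conformal_map_def bij_betw_def)
  have nest: "f n ` cball 0 r \<subseteq> f m ` cball 0 r" if "m \<le> n" "r < 1" for m n r
    by (rule schwarz_comparison(2) [OF f(1)])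
       (use holf imf f(2) decseqD [OF D] that in auto)
  have comp: "compact (f m ` cball 0 r)" if "r < 1" for m r
    using that
    by (intro compact_continuous_image holomorphic_on_imp_continuous_on
          holomorphic_on_subset [OF holf]) auto
  obtain g s where g: "g holomorphic_on ball 0 1" and s: "strict_mono (s :: nat \<Rightarrow> nat)"
    and lim: "\<And>x. x \<in> ball 0 1 \<Longrightarrow> (\<lambda>n. f (s n) x) \<longlonglongrightarrow> g x"
    and ulim: "\<And>K. compact K \<Longrightarrow> K \<subseteq> ball 0 1 \<Longrightarrow> uniform_limit K (f \<circ> s) g sequentially"
  proof (rule Montel [OF open_ball, of "range f" 0 1 f])
    show "h holomorphic_on ball 0 1" if "h \<in> range f" for h
      using that holf by auto
    show "\<exists>B. \<forall>h\<in>range f. \<forall>z\<in>K. norm (h z) \<le> B" if K: "compact K" "K \<subseteq> ball 0 1" for K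
    proof -
      obtain r where r: "r < 1" "K \<subseteq> cball 0 r"
        using compact_subset_unit_disk [OF K] by metis
      obtain B where "\<And>v. v \<in> f 0 ` cball 0 r \<Longrightarrow> norm v \<le> B"
        using compact_imp_bounded [OF comp [OF r(1)]] by (metis bounded_iff)
      then show ?thesis
        using nest [OF le0 r(1)] r(2) by (intro exI [of _ B]) blast
    qed
  qed auto
  have "uniform_limit (ball 0 (1/2)) (f \<circ> s) g sequentially"
    by (rule uniform_limit_on_subset [OF ulim [of "cball 0 (1/2)"]]) auto
  then have "(\<lambda>n. deriv ((f \<circ> s) n) 0) \<longlonglongrightarrow> deriv g 0"
    by (rule deriv_complex_uniform_limit)
       (auto intro!: always_eventually holomorphic_on_subset [OF holf])
  then have "c \<le> norm (deriv g 0)"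
    by (rule tendsto_lowerbound [OF tendsto_norm]) (use c in \<open>auto intro!: always_eventually\<close>)
  moreover have "g 0 = w"
    using lim [of 0] f(2) LIMSEQ_unique [OF _ tendsto_const] by simp
  moreover have "g ` ball 0 1 \<subseteq> D m" for m
  proof clarify
    fix z :: complex
    assume "z \<in> ball 0 1"
    then have z: "norm z < 1"
      by simp
    have "g z \<in> f m ` cball 0 (norm z)"
    proof (rule Lim_in_closed_set [OF _ _ _ lim])
      show "closed (f m ` cball 0 (norm z))"
        using comp [OF z] by (rule compact_imp_closed)
      show "\<forall>\<^sub>F n in sequentially. f (s n) z \<in> f m ` cball 0 (norm z)"
        using eventually_ge_at_top [of m]
      proof eventually_elim
        case (elim n)
        then have "m \<le> s n"
          using seq_suble [OF s, of n] by simp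
        from nest [OF this z] show ?case
          by auto
      qed
    qed (use z in auto)
    then show "g z \<in> D m"
      using z imf by fastforce
  qed
  ultimately show ?thesis
    using that g by blast
qed

section \<open>One-sided continuity of an increasing family of domains\<close>

text \<open>The conformal radius is the value of an extremal problem over all holomorphic maps of the
  disk into the domain.  Lower bounds for it thus come from arbitrary competitors, such as
  shrunken Riemann maps and limits of Riemann maps of other domains.\<close>

lemma conformal_radius_ge_deriv:
  assumes D: "simply_connected_domain D" "D \<noteq> UNIV"
    and g: "g holomorphic_on ball 0 1" "g ` ball 0 1 \<subseteq> D"
  shows "norm (deriv g 0) \<le> conformal_radius D (g 0)"
proof -
  have "g 0 \<in> D"
    using g(2) by (auto simp: image_subset_iff)
  from riemann_map_exists [OF D this] obtain f where f: "conformal_map f (ball 0 1) D"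
    "f 0 = g 0" "norm (deriv f 0) = conformal_radius D (g 0)"
    by blast
  then show ?thesis
    using schwarz_comparison(1) [OF f(1) g] by simp
qed

locale increasing_domains =
  fixes \<Omega> :: "real \<Rightarrow> complex set"
  assumes domain: "0 \<le> t \<Longrightarrow> simply_connected_domain (\<Omega> t)"
    and proper: "0 \<le> t \<Longrightarrow> \<Omega> t \<noteq> UNIV"
    and nested: "0 \<le> s \<Longrightarrow> s \<le> t \<Longrightarrow> \<Omega> s \<subseteq> \<Omega> t"
begin

definition left_continuous :: bool where
  "left_continuous \<longleftrightarrow>
     (\<forall>t>0. \<forall>C. compact C \<and> C \<subseteq> \<Omega> t \<longrightarrow> (\<exists>s. 0 \<le> s \<and> s < t \<and> C \<subseteq> \<Omega> s))"

text \<open>The domain \<open>V\<close> has to meet the initial domain because the interior of the intersection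
  of all later domains may have several components; the kernel of a sequence of later domains
  with respect to a point of the initial domain is the component that contains this point.\<close>

definition right_continuous :: bool where
  "right_continuous \<longleftrightarrow>
     (\<forall>t\<ge>0. \<forall>V. plane_domain V \<and> V \<inter> \<Omega> 0 \<noteq> {} \<and> (\<forall>s>t. V \<subseteq> \<Omega> s) \<longrightarrow> V \<subseteq> \<Omega> t)"

lemma plane_domain: "0 \<le> t \<Longrightarrow> plane_domain (\<Omega> t)"
  using domain by (simp add: simply_connected_domain_def)

lemma initial_subset: "0 \<le> t \<Longrightarrow> \<Omega> 0 \<subseteq> \<Omega> t"
  using nested by simp

lemma riemann_map:
  assumes "0 \<le> t" "w \<in> \<Omega> 0"
  obtains f where "conformal_map f (ball 0 1) (\<Omega> t)" "f 0 = w"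
    "norm (deriv f 0) = conformal_radius (\<Omega> t) w" "conformal_radius (\<Omega> t) w > 0"
    "f holomorphic_on ball 0 1" "f ` ball 0 1 = \<Omega> t"
proof -
  have "w \<in> \<Omega> t"
    using assms initial_subset by blast
  from riemann_map_exists [OF domain proper this] assms(1)
  obtain f where "conformal_map f (ball 0 1) (\<Omega> t)" "f 0 = w"
    "norm (deriv f 0) = conformal_radius (\<Omega> t) w" "conformal_radius (\<Omega> t) w > 0"
    by blast
  then show ?thesis
    using that by (auto simp: conformal_map_def bij_betw_def)
qed

lemma conformal_radius_mono:
  assumes "0 \<le> s" "s \<le> t" "w \<in> \<Omega> 0"
  shows "conformal_radius (\<Omega> s) w \<le> conformal_radius (\<Omega> t) w"
proof -
  from riemann_map [OF assms(1,3)] obtain f where f: "f 0 = w"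
    "norm (deriv f 0) = conformal_radius (\<Omega> s) w"
    "f holomorphic_on ball 0 1" "f ` ball 0 1 = \<Omega> s"
    by blast
  have "norm (deriv f 0) \<le> conformal_radius (\<Omega> t) (f 0)"
    by (rule conformal_radius_ge_deriv) (use assms f domain proper nested in auto)
  then show ?thesis
    using f by simp
qed

subsection \<open>Kernel convergence\<close>

text \<open>Each half of continuity is read off from one sequence that approaches \<open>t\<close> strictly from the
  side in question.\<close>

lemma inclusion_chain_imp_left_continuous:
  assumes "inclusion_chain \<Omega>"
  shows left_continuous
  unfolding left_continuous_def
proof clarify
  fix t :: real and C
  assume t: "0 < t" and C: "compact C" "C \<subseteq> \<Omega> t"
  define \<tau> where "\<tau> n = t - t / (real n + 1)" for n
  have \<tau>: "0 \<le> \<tau> n" "\<tau> n < t" for n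
    using t by (auto simp: \<tau>_def divide_simps)
  obtain w where w: "w \<in> \<Omega> 0"
    using plane_domain [of 0] by (auto simp: plane_domain_def)
  have "\<tau> \<longlonglongrightarrow> t"
    unfolding \<tau>_def by real_asymp
  then have "kernel_converges w (\<lambda>n. \<Omega> (\<tau> n)) (\<Omega> t)"
    using assms \<tau>(1) t w by (simp add: inclusion_chain_def)
  then have "is_kernel w ((\<lambda>n. \<Omega> (\<tau> n)) \<circ> id) (\<Omega> t)"
    unfolding kernel_converges_def using strict_mono_id by blast
  then have "\<forall>\<^sub>F n in sequentially. C \<subseteq> \<Omega> (\<tau> n)"
    using C by (simp add: is_kernel_def eventually_exhausted_def)
  then obtain n where "C \<subseteq> \<Omega> (\<tau> n)"
    by (auto simp: eventually_sequentially)
  then show "\<exists>s\<ge>0. s < t \<and> C \<subseteq> \<Omega> s"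
    using \<tau> by blast
qed

lemma inclusion_chain_imp_right_continuous:
  assumes "inclusion_chain \<Omega>"
  shows right_continuous
  unfolding right_continuous_def
proof (intro allI impI, elim conjE)
  fix t :: real and V
  assume t: "0 \<le> t" and V: "plane_domain V" "V \<inter> \<Omega> 0 \<noteq> {}" "\<forall>s>t. V \<subseteq> \<Omega> s"
  define \<tau> where "\<tau> n = t + 1 / (real n + 1)" for n
  have \<tau>: "0 \<le> \<tau> n" "t < \<tau> n" for n
    using t by (auto simp: \<tau>_def)
  obtain w where w: "w \<in> \<Omega> 0" "w \<in> V"
    using V(2) by blast
  have "\<tau> \<longlonglongrightarrow> t"
    unfolding \<tau>_def by real_asymp
  then have "kernel_converges w (\<lambda>n. \<Omega> (\<tau> n)) (\<Omega> t)"
    using assms \<tau>(1) t w by (simp add: inclusion_chain_def)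
  then have "is_kernel w ((\<lambda>n. \<Omega> (\<tau> n)) \<circ> id) (\<Omega> t)"
    unfolding kernel_converges_def using strict_mono_id by blast
  moreover have "eventually_exhausted ((\<lambda>n. \<Omega> (\<tau> n)) \<circ> id) V"
    using V(3) \<tau>(2) by (auto simp: eventually_exhausted_def intro!: always_eventually)
  ultimately show "V \<subseteq> \<Omega> t"
    using V(1) w(2) by (simp add: is_kernel_def)
qed

text \<open>Left continuity exhausts compact sets however the sequence approaches \<open>t\<close>, since indices
  to the right only enlarge the domains.  A competitor \<open>K\<close> for the kernel is covered pointwise by
  domains with indices close to \<open>t\<close>, so it lies in every later domain and right continuity
  applies.\<close>

lemma is_kernel_of_continuous:
  assumes cont: left_continuous right_continuous
    and \<tau>: "\<And>n. 0 \<le> \<tau> n" "\<tau> \<longlonglongrightarrow> t" and "0 \<le> t" and w: "w \<in> \<Omega> 0"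
  shows "is_kernel w (\<lambda>n. \<Omega> (\<tau> n)) (\<Omega> t)"
  unfolding is_kernel_def
proof (intro conjI allI impI, goal_cases)
  case 1
  show ?case
    using plane_domain [OF \<open>0 \<le> t\<close>] .
next
  case 2
  show ?case
    using w initial_subset [OF \<open>0 \<le> t\<close>] by blast
next
  case 3
  show ?case
    unfolding eventually_exhausted_def
  proof clarify
    fix C
    assume C: "compact C" "C \<subseteq> \<Omega> t"
    show "\<forall>\<^sub>F n in sequentially. C \<subseteq> \<Omega> (\<tau> n)"
    proof (cases "t = 0")
      case True
      then have "C \<subseteq> \<Omega> (\<tau> n)" for n
        using C(2) initial_subset [OF \<tau>(1)] by blast
      then show ?thesis
        by simp
    next
      case False
      then obtain s where s: "0 \<le> s" "s < t" "C \<subseteq> \<Omega> s"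
        using cont(1) \<open>0 \<le> t\<close> C unfolding left_continuous_def by (metis order_le_less)
      show ?thesis
        using order_tendstoD(1) [OF \<tau>(2) s(2)]
      proof eventually_elim
        case (elim n)
        then show ?case
          using s(3) nested [OF s(1), of "\<tau> n"] by auto
      qed
    qed
  qed
next
  case (4 K)
  have "K \<subseteq> \<Omega> s" if "t < s" for s
  proof
    fix x
    assume "x \<in> K"
    then have "\<forall>\<^sub>F n in sequentially. x \<in> \<Omega> (\<tau> n)"
      using 4 by (auto simp: eventually_exhausted_def dest: spec [of _ "{x}"])
    then have "\<forall>\<^sub>F n in sequentially. x \<in> \<Omega> (\<tau> n) \<and> \<tau> n < s"
      using order_tendstoD(2) [OF \<tau>(2) that] by eventually_elim blast
    then obtain n where n: "x \<in> \<Omega> (\<tau> n)" "\<tau> n < s"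
      by (auto simp: eventually_sequentially)
    then show "x \<in> \<Omega> s"
      using nested [OF \<tau>(1) less_imp_le [OF n(2)]] by blast
  qed
  then show ?case
    using cont(2) 4 w \<open>0 \<le> t\<close> unfolding right_continuous_def by blast
qed

proposition inclusion_chain_iff:
  "inclusion_chain \<Omega> \<longleftrightarrow> left_continuous \<and> right_continuous"
proof
  assume "inclusion_chain \<Omega>"
  then show "left_continuous \<and> right_continuous"
    using inclusion_chain_imp_left_continuous inclusion_chain_imp_right_continuous by blast
next
  assume cont: "left_continuous \<and> right_continuous"
  have "kernel_converges w (\<lambda>n. \<Omega> (\<tau> n)) (\<Omega> t)"
    if \<tau>: "\<And>n. 0 \<le> \<tau> n" "\<tau> \<longlonglongrightarrow> t" and "0 \<le> t" "w \<in> \<Omega> 0" for \<tau> t w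
    unfolding kernel_converges_def
  proof (intro conjI allI impI)
    show "plane_domain (\<Omega> (\<tau> n))" for n
      using plane_domain \<tau>(1) .
    show "\<exists>U. open U \<and> w \<in> U \<and> (\<forall>n. U \<subseteq> \<Omega> (\<tau> n))"
      using plane_domain [of 0] \<open>w \<in> \<Omega> 0\<close> initial_subset [OF \<tau>(1)]
      by (auto simp: plane_domain_def intro!: exI [of _ "\<Omega> 0"])
    show "is_kernel w ((\<lambda>n. \<Omega> (\<tau> n)) \<circ> \<phi>) (\<Omega> t)" if "strict_mono \<phi>" for \<phi>
    proof -
      have "(\<lambda>n. \<tau> (\<phi> n)) \<longlonglongrightarrow> t"
        using LIMSEQ_subseq_LIMSEQ [OF \<tau>(2) that] by (simp add: o_def)
      from is_kernel_of_continuous [OF _ _ _ this] show ?thesis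
        using cont \<tau>(1) \<open>0 \<le> t\<close> \<open>w \<in> \<Omega> 0\<close> by (simp add: o_def)
    qed
  qed
  then show "inclusion_chain \<Omega>"
    using domain proper nested by (simp add: inclusion_chain_def)
qed

subsection \<open>The conformal radius\<close>

text \<open>Left continuity of the domains gives that of the radius by shrinking a Riemann map \<open>f\<close> of
  \<open>\<Omega> t\<close> to \<open>z \<mapsto> f (\<rho> z)\<close>, whose image has compact closure in \<open>\<Omega> t\<close> and so fits into an
  earlier domain.  Conversely, a compact set \<open>C\<close> lies in the image of a disk of radius
  \<open>r < 1\<close>; an earlier domain that misses a point of \<open>C\<close> has a radius smaller than that of
  \<open>\<Omega> t\<close> by a fixed factor depending only on \<open>r\<close>.\<close>

proposition left_continuous_iff:
  assumes w: "w \<in> \<Omega> 0"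
  shows "left_continuous \<longleftrightarrow>
    (\<forall>t>0. \<forall>c<conformal_radius (\<Omega> t) w. \<exists>s. 0 \<le> s \<and> s < t \<and> c < conformal_radius (\<Omega> s) w)"
    (is "_ \<longleftrightarrow> ?radius")
proof
  assume L: left_continuous
  show ?radius
  proof (intro allI impI)
    fix t c :: real
    assume t: "0 < t" and c: "c < conformal_radius (\<Omega> t) w"
    from riemann_map [OF less_imp_le [OF t] w] obtain f where f: "f 0 = w"
      "norm (deriv f 0) = conformal_radius (\<Omega> t) w" "conformal_radius (\<Omega> t) w > 0"
      "f holomorphic_on ball 0 1" "f ` ball 0 1 = \<Omega> t"
      by blast
    have "max 0 (c / conformal_radius (\<Omega> t) w) < 1"
      using c f(3) by simp
    then obtain \<rho> where \<rho>: "max 0 (c / conformal_radius (\<Omega> t) w) < \<rho>" "\<rho> < 1"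
      using dense by blast
    have sub: "cball 0 \<rho> \<subseteq> ball (0::complex) 1"
      using \<rho>(2) by auto
    have "compact (f ` cball 0 \<rho>)"
      by (intro compact_continuous_image holomorphic_on_imp_continuous_on
            holomorphic_on_subset [OF f(4) sub] compact_cball)
    moreover have "f ` cball 0 \<rho> \<subseteq> \<Omega> t"
      using f(5) sub by blast
    ultimately obtain s where s: "0 \<le> s" "s < t" "f ` cball 0 \<rho> \<subseteq> \<Omega> s"
      using L t unfolding left_continuous_def by blast
    define g where "g = (\<lambda>z. f (of_real \<rho> * z))"
    have im: "of_real \<rho> * z \<in> cball 0 \<rho>" if "z \<in> ball 0 1" for z :: complex
      using that \<rho>(1) by (simp add: norm_mult mult_left_le)
    have "(f \<circ> (\<lambda>z. of_real \<rho> * z)) holomorphic_on ball 0 1"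
      by (rule holomorphic_on_compose_gen [OF _ f(4)])
         (use im sub in \<open>auto intro!: holomorphic_intros\<close>)
    then have holg: "g holomorphic_on ball 0 1"
      by (simp add: g_def o_def)
    have "(f \<circ> (\<lambda>z. of_real \<rho> * z) has_field_derivative deriv f 0 * of_real \<rho>) (at 0)"
      by (rule DERIV_chain)
         (use f(4) in \<open>auto intro!: holomorphic_derivI derivative_eq_intros\<close>)
    then have "deriv g 0 = deriv f 0 * of_real \<rho>"
      unfolding g_def o_def by (rule DERIV_imp_deriv)
    then have dg: "norm (deriv g 0) = conformal_radius (\<Omega> t) w * \<rho>"
      using f(2) \<rho>(1) by (simp add: norm_mult)
    have "c < conformal_radius (\<Omega> t) w * \<rho>"
      using \<rho>(1) f(3) by (simp add: divide_less_eq mult.commute)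
    also have "\<dots> \<le> conformal_radius (\<Omega> s) (g 0)"
      unfolding dg [symmetric]
      by (rule conformal_radius_ge_deriv [OF domain proper holg])
         (use s im in \<open>auto simp: g_def\<close>)
    finally show "\<exists>s\<ge>0. s < t \<and> c < conformal_radius (\<Omega> s) w"
      using s f(1) by (auto simp: g_def)
  qed
next
  assume R: ?radius
  show left_continuous
    unfolding left_continuous_def
  proof (intro allI impI, elim conjE)
    fix t :: real and C
    assume t: "0 < t" and C: "compact C" "C \<subseteq> \<Omega> t"
    from riemann_map [OF less_imp_le [OF t] w] obtain f where f:
      "conformal_map f (ball 0 1) (\<Omega> t)" "f 0 = w"
      "norm (deriv f 0) = conformal_radius (\<Omega> t) w" "conformal_radius (\<Omega> t) w > 0"
      by blast
    obtain k where k: "k holomorphic_on \<Omega> t" "k ` \<Omega> t \<subseteq> ball 0 1"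
      "\<And>v. v \<in> \<Omega> t \<Longrightarrow> f (k v) = v"
      using conformal_map_inverse [OF f(1) open_ball] by metis
    have "compact (k ` C)"
      by (intro compact_continuous_image holomorphic_on_imp_continuous_on
            holomorphic_on_subset [OF k(1)] C)
    moreover have "k ` C \<subseteq> ball 0 1"
      using k(2) C(2) by blast
    ultimately obtain r where r: "0 < r" "r < 1" "k ` C \<subseteq> cball 0 r"
      by (rule compact_subset_unit_disk)
    have "2 * sqrt r / (1 + r) * conformal_radius (\<Omega> t) w < conformal_radius (\<Omega> t) w"
      using mult_strict_right_mono [OF sqrt_bound_less_1 [OF less_imp_le [OF r(1)] r(2)] f(4)]
      by (simp only: mult_1_left)
    then obtain s where s: "0 \<le> s" "s < t"
      "2 * sqrt r / (1 + r) * conformal_radius (\<Omega> t) w < conformal_radius (\<Omega> s) w"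
      using R t by blast
    from riemann_map [OF s(1) w] obtain g where g: "g 0 = w"
      "norm (deriv g 0) = conformal_radius (\<Omega> s) w"
      "g holomorphic_on ball 0 1" "g ` ball 0 1 = \<Omega> s"
      by blast
    have "p \<in> \<Omega> s" if "p \<in> C" for p
    proof (rule ccontr)
      assume "p \<notin> \<Omega> s"
      have p: "f (k p) = p"
        using k(3) C(2) that by blast
      have "norm (deriv g 0) \<le> 2 * sqrt r / (1 + r) * norm (deriv f 0)"
      proof (rule deriv_bound_of_omitted_point [OF f(1) g(3)])
        show "norm (k p) \<le> r"
          using r(3) that by auto
        show "g ` ball 0 1 \<subseteq> \<Omega> t"
          unfolding g(4) using nested s by simp
      qed (use g f r p \<open>p \<notin> \<Omega> s\<close> in simp_all)
      then show False
        using s(3) f(3) g(2) by simp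
    qed
    then show "\<exists>s\<ge>0. s < t \<and> C \<subseteq> \<Omega> s"
      using s by blast
  qed
qed

text \<open>If the radii of the later domains stay above that of \<open>\<Omega> t\<close>, a limit \<open>g\<close> of their Riemann
  maps has too large a derivative for a map into \<open>\<Omega> t\<close>, although its image is a domain inside all
  later ones, as right continuity requires.  Conversely, let \<open>K\<close> lie in all later domains and
  reach a point \<open>p\<close> outside \<open>\<Omega> t\<close>.  On the connected set \<open>K \<union> \<Omega> t\<close> all inverse Riemann maps are
  disk-valued and vanish at \<open>w\<close>, so they keep \<open>p\<close> in a common disk of radius \<open>r < 1\<close>; omitting
  \<open>p\<close> then costs \<open>\<Omega> t\<close> a fixed factor against every later radius.\<close>

proposition right_continuous_iff:
  assumes w: "w \<in> \<Omega> 0"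
  shows "right_continuous \<longleftrightarrow>
    (\<forall>t\<ge>0. \<forall>c>conformal_radius (\<Omega> t) w. \<exists>s>t. conformal_radius (\<Omega> s) w < c)"
    (is "_ \<longleftrightarrow> ?radius")
proof
  assume R: right_continuous
  show ?radius
  proof (intro allI impI, rule ccontr)
    fix t c :: real
    assume t: "0 \<le> t" and c: "conformal_radius (\<Omega> t) w < c"
      and "\<not> (\<exists>s>t. conformal_radius (\<Omega> s) w < c)"
    then have ge: "c \<le> conformal_radius (\<Omega> s) w" if "t < s" for s
      using that by (meson not_less)
    define \<tau> where "\<tau> n = t + 1 / (real n + 1)" for n
    have \<tau>: "0 \<le> \<tau> n" "t < \<tau> n" for n
      using t by (auto simp: \<tau>_def)
    have "\<exists>f. conformal_map f (ball 0 1) (\<Omega> (\<tau> n)) \<and> f 0 = w \<and>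
        norm (deriv f 0) = conformal_radius (\<Omega> (\<tau> n)) w" for n
      using riemann_map [OF \<tau>(1) w, of n] by metis
    then obtain f where f: "\<And>n. conformal_map (f n) (ball 0 1) (\<Omega> (\<tau> n))" "\<And>n. f n 0 = w"
      "\<And>n. norm (deriv (f n) 0) = conformal_radius (\<Omega> (\<tau> n)) w"
      by metis
    have dec: "decseq (\<lambda>n. \<Omega> (\<tau> n))"
      unfolding decseq_def
      by (intro allI impI nested \<tau>) (auto simp: \<tau>_def frac_le)
    have "c \<le> norm (deriv (f n) 0)" for n
      using f(3) ge [OF \<tau>(2)] by simp
    from limit_map_into_decreasing_domains [OF f(1,2) dec this]
    obtain g where g: "g holomorphic_on ball 0 1" "g 0 = w"
      "\<And>n. g ` ball 0 1 \<subseteq> \<Omega> (\<tau> n)" "c \<le> norm (deriv g 0)"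
      by blast
    have "0 < conformal_radius (\<Omega> t) w"
      using riemann_map [OF t w] by metis
    then have "deriv g 0 \<noteq> 0"
      using g(4) c by auto
    have "\<not> g constant_on ball 0 1"
    proof
      assume "g constant_on ball 0 1"
      then have "w = g z" if "z \<in> ball 0 1" for z
        using g(2) that unfolding constant_on_def by (metis centre_in_ball zero_less_one)
      then have "(g has_field_derivative 0) (at 0)"
        by (rule has_field_derivative_transform_within_open
              [OF DERIV_const open_ball [of 0 1], rotated]) simp_all
      with \<open>deriv g 0 \<noteq> 0\<close> show False
        using DERIV_imp_deriv by blast
    qed
    then have "open (g ` ball 0 1)"
      by (intro open_mapping_thm [OF g(1)]) auto
    moreover have "connected (g ` ball 0 1)"
      by (intro connected_continuous_image holomorphic_on_imp_continuous_on g) auto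
    moreover have "w \<in> g ` ball 0 1"
      using g(2) by force
    ultimately have V: "plane_domain (g ` ball 0 1)" "g ` ball 0 1 \<inter> \<Omega> 0 \<noteq> {}"
      using w unfolding plane_domain_def by blast+
    have "g ` ball 0 1 \<subseteq> \<Omega> s" if "t < s" for s
    proof -
      have "\<tau> \<longlonglongrightarrow> t"
        unfolding \<tau>_def by real_asymp
      then obtain n where "\<tau> n < s"
        using order_tendstoD(2) [of \<tau> t sequentially s] \<open>t < s\<close>
        by (auto simp: eventually_sequentially)
      then show ?thesis
        using g(3) [of n] nested [OF \<tau>(1), of n s] by simp
    qed
    then have "g ` ball 0 1 \<subseteq> \<Omega> t"
      using R V t unfolding right_continuous_def by blast
    from conformal_radius_ge_deriv [OF domain [OF t] proper [OF t] g(1) this] show False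
      using g(2,4) c by simp
  qed
next
  assume R: ?radius
  show right_continuous
    unfolding right_continuous_def
  proof (intro allI impI, elim conjE)
    fix t :: real and K
    assume t: "0 \<le> t" and K: "plane_domain K" "K \<inter> \<Omega> 0 \<noteq> {}" "\<forall>s>t. K \<subseteq> \<Omega> s"
    (* K need not contain w; both sets contain K \<inter> \<Omega> 0, so the union is connected. *)
    define V where "V = K \<union> \<Omega> t"
    have V: "open V" "connected V" "w \<in> V"
      using K(1,2) plane_domain [OF t] initial_subset [OF t] w
      by (auto simp: V_def plane_domain_def intro!: connected_Un)
    have Vs: "V \<subseteq> \<Omega> s" if "t < s" for s
      using K(3) nested [OF t, of s] that by (auto simp: V_def)
    have "p \<in> \<Omega> t" if "p \<in> K" for p
    proof (rule ccontr)
      assume p: "p \<notin> \<Omega> t"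
      have "p \<in> V"
        using that by (simp add: V_def)
      from uniform_bound_of_disk_valued [OF V this] obtain r where r: "0 < r" "r < 1"
        "\<And>h. h holomorphic_on V \<Longrightarrow> h ` V \<subseteq> ball 0 1 \<Longrightarrow> h w = 0 \<Longrightarrow> norm (h p) \<le> r"
        by blast
      define \<kappa> where "\<kappa> = 2 * sqrt r / (1 + r)"
      have \<kappa>: "0 < \<kappa>" "\<kappa> < 1"
        using r sqrt_bound_less_1 [of r] by (auto simp: \<kappa>_def)
      from riemann_map [OF t w] obtain g where g: "g 0 = w"
        "norm (deriv g 0) = conformal_radius (\<Omega> t) w" "conformal_radius (\<Omega> t) w > 0"
        "g holomorphic_on ball 0 1" "g ` ball 0 1 = \<Omega> t"
        by blast
      have "conformal_radius (\<Omega> t) w < conformal_radius (\<Omega> t) w / \<kappa>"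
        using \<kappa> g(3) by (simp add: pos_less_divide_eq)
      then obtain s where s: "t < s" "conformal_radius (\<Omega> s) w < conformal_radius (\<Omega> t) w / \<kappa>"
        using R t by blast
      have "0 \<le> s"
        using s t by simp
      from riemann_map [OF this w] obtain f where f:
        "conformal_map f (ball 0 1) (\<Omega> s)" "f 0 = w"
        "norm (deriv f 0) = conformal_radius (\<Omega> s) w"
        by blast
      obtain k where k: "k holomorphic_on \<Omega> s" "k ` \<Omega> s \<subseteq> ball 0 1"
        "\<And>z. z \<in> ball 0 1 \<Longrightarrow> k (f z) = z" "\<And>v. v \<in> \<Omega> s \<Longrightarrow> f (k v) = v"
        using conformal_map_inverse [OF f(1) open_ball] by metis
      have "norm (k p) \<le> r"
      proof (rule r(3))
        show "k holomorphic_on V" "k ` V \<subseteq> ball 0 1"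
          using k(1,2) Vs [OF s(1)] holomorphic_on_subset by blast+
        show "k w = 0"
          using k(3) [of 0] f(2) by simp
      qed
      have "norm (deriv g 0) \<le> \<kappa> * norm (deriv f 0)"
        unfolding \<kappa>_def
      proof (rule deriv_bound_of_omitted_point [OF f(1) g(4) _ _ \<open>norm (k p) \<le> r\<close> r(2)])
        show "g ` ball 0 1 \<subseteq> \<Omega> s"
          unfolding g(5) using nested t s by simp
        show "f (k p) \<notin> g ` ball 0 1"
          unfolding g(5) using k(4) Vs [OF s(1)] \<open>p \<in> V\<close> p by auto
      qed (use g f in simp)
      then show False
        using s(2) \<kappa>(1) f(3) g(2) by (simp add: pos_less_divide_eq mult.commute)
    qed
    then show "K \<subseteq> \<Omega> t"
      by blast
  qed
qed

end

text \<open>For a monotone function, each one-sided half of continuity says that single points on that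
  side have values close to \<open>f t\<close>: monotonicity extends the estimate to everything in
  between, and the other side is controlled for free.\<close>

lemma mono_continuous_on_half_line_iff:
  fixes f :: "real \<Rightarrow> real"
  assumes f: "mono_on {0..} f"
  shows "continuous_on {0..} f \<longleftrightarrow>
    (\<forall>t>0. \<forall>c<f t. \<exists>s. 0 \<le> s \<and> s < t \<and> c < f s) \<and> (\<forall>t\<ge>0. \<forall>c>f t. \<exists>s>t. f s < c)"
proof (intro iffI conjI allI impI)
  fix t c :: real
  assume cont: "continuous_on {0..} f" and t: "0 < t" "c < f t"
  have "(f \<longlongrightarrow> f t) (at t within {0..})"
    using cont t by (simp add: continuous_on_def)
  from order_tendstoD(1) [OF this t(2)] obtain d where d: "0 < d"
    "\<And>x. 0 \<le> x \<Longrightarrow> x \<noteq> t \<Longrightarrow> dist x t < d \<Longrightarrow> c < f x"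
    by (auto simp: eventually_at)
  show "\<exists>s\<ge>0. s < t \<and> c < f s"
    by (rule exI [of _ "max 0 (t - d / 2)"]) (use d t in \<open>auto simp: dist_real_def max_def\<close>)
next
  fix t c :: real
  assume cont: "continuous_on {0..} f" and t: "0 \<le> t" "f t < c"
  have "(f \<longlongrightarrow> f t) (at t within {0..})"
    using cont t by (simp add: continuous_on_def)
  from order_tendstoD(2) [OF this t(2)] obtain d where d: "0 < d"
    "\<And>x. 0 \<le> x \<Longrightarrow> x \<noteq> t \<Longrightarrow> dist x t < d \<Longrightarrow> f x < c"
    by (auto simp: eventually_at)
  show "\<exists>s>t. f s < c"
    by (rule exI [of _ "t + d / 2"]) (use d t in \<open>auto simp: dist_real_def\<close>)
next
  assume H: "(\<forall>t>0. \<forall>c<f t. \<exists>s. 0 \<le> s \<and> s < t \<and> c < f s) \<and> (\<forall>t\<ge>0. \<forall>c>f t. \<exists>s>t. f s < c)"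
  have mono: "f x \<le> f y" if "0 \<le> x" "x \<le> y" for x y
    using mono_onD [OF f] that by auto
  have "(f \<longlongrightarrow> f t) (at t within {0..})" if "0 \<le> t" for t
  proof (rule order_tendstoI)
    fix c
    assume c: "c < f t"
    show "\<forall>\<^sub>F x in at t within {0..}. c < f x"
    proof (cases "t = 0")
      case True
      then have "c < f x" if "0 \<le> x" for x
        using mono [of 0 x] c that by simp
      then show ?thesis
        by (auto simp: eventually_at intro!: exI [of _ 1])
    next
      case False
      then obtain s where s: "0 \<le> s" "s < t" "c < f s"
        using H c \<open>0 \<le> t\<close> by (metis order_le_less)
      have "c < f x" if "dist x t < t - s" for x
        using mono [of s x] s that by (simp add: dist_real_def abs_less_iff)
      then show ?thesis
        unfolding eventually_at using s(2) by (intro exI [of _ "t - s"]) auto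
    qed
  next
    fix c
    assume "f t < c"
    then obtain s where s: "t < s" "f s < c"
      using H \<open>0 \<le> t\<close> by blast
    have "f x < c" if "0 \<le> x" "dist x t < s - t" for x
      using mono [of x s] s that by (simp add: dist_real_def abs_less_iff)
    then show "\<forall>\<^sub>F x in at t within {0..}. f x < c"
      unfolding eventually_at using s(1) by (intro exI [of _ "s - t"]) auto
  qed
  then show "continuous_on {0..} f"
    by (simp add: continuous_on_def)
qed

section \<open>The characterization\<close>

theorem theorem1p8:
  fixes \<Omega> :: "real \<Rightarrow> complex set"
  assumes "\<And>t. 0 \<le> t \<Longrightarrow> simply_connected_domain (\<Omega> t)"
    and "\<And>s t. 0 \<le> s \<Longrightarrow> s \<le> t \<Longrightarrow> \<Omega> s \<subseteq> \<Omega> t \<and> \<Omega> t \<noteq> UNIV"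
  shows "(inclusion_chain \<Omega> \<longleftrightarrow>
            (\<exists>w\<in>\<Omega> 0. continuous_on {0..} (\<lambda>t. conformal_radius (\<Omega> t) w))) \<and>
         (inclusion_chain \<Omega> \<longleftrightarrow>
            (\<forall>w\<in>\<Omega> 0. mono_on {0..} (\<lambda>t. conformal_radius (\<Omega> t) w) \<and>
                      continuous_on {0..} (\<lambda>t. conformal_radius (\<Omega> t) w)))"
proof -
  interpret increasing_domains \<Omega>
    by unfold_locales (use assms in blast)+
  have mono: "mono_on {0..} (\<lambda>t. conformal_radius (\<Omega> t) w)" if "w \<in> \<Omega> 0" for w
    using conformal_radius_mono that by (auto intro!: mono_onI)
  have "inclusion_chain \<Omega> \<longleftrightarrow> continuous_on {0..} (\<lambda>t. conformal_radius (\<Omega> t) w)"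
    if "w \<in> \<Omega> 0" for w
    unfolding inclusion_chain_iff left_continuous_iff [OF that] right_continuous_iff [OF that]
      mono_continuous_on_half_line_iff [OF mono [OF that]] ..
  moreover have "\<Omega> 0 \<noteq> {}"
    using plane_domain [of 0] by (simp add: plane_domain_def)
  ultimately show ?thesis
    using mono by blast
qed

end
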